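(* Let $K$ be a field, let $\psi\colon D\to E$ be a morphism of dialgebras over $K$, and let $\Theta_t=\sum_{n=0}^\infty\theta_nt^n$ be a deformation of $\psi$. Then the infinitesimal $\theta_1$ is a $2$-cocycle in $CY^2(\psi,\psi)$. More generally, if $\theta_i=0$ for $i=1,2,\dots,n$, then $\theta_{n+1}$ is a $2$-cocycle in $CY^2(\psi,\psi)$.
   Context: **Dialgebras.** All tensor products and $\mathrm{Hom}$'s are over the field $K$. A dialgebra over $K$ is a $K$-module $D$ with two $K$-bilinear maps $\dashv,\vdash\colon D\otimes D\to D$ (left and right product) such that for all $x,y,z$: (1) $x\dashv(y\dashv z)=(x\dashv y)\dashv z$; (2) $(x\dashv y)\dashv z=x\dashv(y\vdash z)$; (3) $(x\vdash y)\dashv z=x\vdash(y\dashv z)$; (4) $(x\dashv y)\vdash z=x\vdash(y\vdash z)$; (5) $x\vdash(y\vdash z)=(x\vdash y)\vdash z$. A morphism of dialgebras is a $K$-linear map preserving both products. A representation of $D$ is a $K$-module $M$ with left actions $\dashv,\vdash\colon D\otimes M\to M$ and right actions $\dashv,\vdash\colon M\otimes D\to M$ satisfying the fifteen identities obtained from (1)–(5) by letting exactly one of $x,y,z$ lie in $M$. $D$ is a representation of itself; given a morphism $\psi\colon D\to E$, $E$ is a representation of $D$ via $a* e=\psi(a)* e$, $e* a=e*\psi(a)$ for $*\in\{\dashv,\vdash\}$. **Trees.** $Y_n$ is the set of planar binary trees with $n+1$ leaves, numbered $0,\dots,n$ from left to right ("$n$-trees"); $Y_0=\{|\}$, and every $y\in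 Y_n$ with $n\ge1$ is uniquely a grafting $y=y_1\vee y_2$ (left subtree $y_1$, right subtree $y_2$). The two $2$-trees are $[21]=|\vee(|\vee|)$ and $[12]=(|\vee|)\vee|$. For $y\in Y_n$, $n\ge1$, $d_iy\in Y_{n-1}$ is obtained by deleting the $i$th leaf. For $y\in Y_{n+1}$ define $\circ^y_i\in\{\dashv,\vdash\}$, $0\le i\le n+1$: $\circ^y_0=\dashv$ if $y=|\vee y_1$ for some $y_1$, and $\vdash$ otherwise; for $1\le i\le n$, $\circ^y_i=\dashv$ if the $i$th leaf is the left branch at its vertex, and $\vdash$ if it is the right branch; $\circ^y_{n+1}=\vdash$ if $y=y_1\vee|$ for some $y_1$, and $\dashv$ otherwise. **Dialgebra cochains.** For a representation $M$ of $D$, $CY^n(D,M)=\mathrm{Hom}(K[Y_n]\otimes D^{\otimes n},M)$ for $n\ge0$, and $\delta=\sum_{i=0}^{n+1}(-1)^i\delta^i\colon CY^n(D,M)\to CY^{n+1}(D,M)$, where $(\delta^if)(y\otimes(a_1,\dots,a_{n+1}))$ equals $a_1\circ^y_0f(d_0y\otimes(a_2,\dots,a_{n+1}))$ if $i=0$; $f(d_iy\otimes(\dots,a_{i-1},a_i\circ^y_ia_{i+1},a_{i+2},\dots))$ if $1\le i\le n$; and $f(d_{n+1}y\otimes(a_1,\dots,a_n))\circ^y_{n+1}a_{n+1}$ if $i=n+1$. **Deformation complex.** For $n\ge1$ put $CY^n(\psi,\psi)=CY^n(D,D)\times CY^n(E,E)\times CY^{n-1}(D,E)$ and $\delta(\xi;\pi;\varphi)=(\delta\xi;\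 \delta\pi;\ \psi\xi-\pi\psi-\delta\varphi)\in CY^{n+1}(\psi,\psi)$, where $(\psi\xi)(y\otimes(a_1,\dots,a_n))=\psi(\xi(y\otimes(a_1,\dots,a_n)))$ and $(\pi\psi)(y\otimes(a_1,\dots,a_n))=\pi(y\otimes(\psi(a_1),\dots,\psi(a_n)))$. This is a cochain complex. **Deformations.** A deformation of a dialgebra $D$ is a pair of power series $f_t=(f^l_t=\sum_{n\ge0}F^l_nt^n;\ f^r_t=\sum_{n\ge0}F^r_nt^n)$ with each $F^l_n,F^r_n\colon D\otimes D\to D$ $K$-bilinear, $F^l_0=\dashv$, $F^r_0=\vdash$, such that $D[[t]]$ with left product $f^l_t$ and right product $f^r_t$ (extended to power series, i.e. $f^*_t(\sum a_it^i,\sum b_jt^j)=\sum F^*_n(a_i,b_j)t^{n+i+j}$) is a dialgebra, denoted $D_t$. The pair $(F^l_n;F^r_n)$ is identified with the cochain $F_n\in CY^2(D,D)$, $F_n([21]\otimes(a,b))=F^l_n(a,b)$, $F_n([12]\otimes(a,b))=F^r_n(a,b)$, and one writes $f_t=\sum F_nt^n$. A deformation of $\psi\colon D\to E$ is a triple $\Theta_t=(f_{D,t};f_{E,t};\Psi_t)$ where $f_{D,t}=\sum F_{D,n}t^n$ and $f_{E,t}=\sum F_{E,n}t^n$ are deformations of $D$ and $E$, and $\Psi_t=\sum_{n\ge0}\psi_nt^n\colon D_t\to E_t$ is a dialgebra morphism with each $\psi_n\colon D\to E$ $K$-linear and $\psi_0=\psi$. Since there is only one $1$-tree, $\psi_n\in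 CY^1(D,E)$, and one writes $\theta_n=(F_{D,n};F_{E,n};\psi_n)\in CY^2(\psi,\psi)$ and $\Theta_t=\sum\theta_nt^n$. The infinitesimal of $\Theta_t$ is $\theta_1$. *)

theory Defs
  imports
    "HOL-Computational_Algebra.Formal_Power_Series"
    "HOL-Library.Function_Algebras"
    "HOL-Library.Product_Plus"
begin

text \<open>
  \<open>Dashv\<close> is the left product and \<open>Vdash\<close> the right product: the two products of a dialgebra
  (and likewise a pair of actions) are bundled into one function taking the symbol as first argument.
\<close>

datatype dsym = Dashv | Vdash

definition bilinear_map ::
  "('k::field \<Rightarrow> 'a::ab_group_add \<Rightarrow> 'a) \<Rightarrow> ('k \<Rightarrow> 'b::ab_group_add \<Rightarrow> 'b) \<Rightarrow>
   ('k \<Rightarrow> 'c::ab_group_add \<Rightarrow> 'c) \<Rightarrow> ('a \<Rightarrow> 'b \<Rightarrow> 'c) \<Rightarrow> bool"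
  where "bilinear_map sa sb sc B \<longleftrightarrow>
    (\<forall>x. Vector_Spaces.linear sb sc (\<lambda>y. B x y)) \<and>
    (\<forall>y. Vector_Spaces.linear sa sc (\<lambda>x. B x y))"

text \<open>
  The five dialgebra identities, stated for four possibly different pairs of products
  \<open>p: X \<times> Y \<rightarrow> U\<close>, \<open>q: Y \<times> Z \<rightarrow> V\<close>, \<open>r: X \<times> V \<rightarrow> W\<close> and \<open>s: U \<times> Z \<rightarrow> W\<close>,
  so that the same formulas serve for dialgebras and for representations.
\<close>

definition dialgebra_identities ::
  "(dsym \<Rightarrow> 'x \<Rightarrow> 'y \<Rightarrow> 'u) \<Rightarrow> (dsym \<Rightarrow> 'y \<Rightarrow> 'z \<Rightarrow> 'v) \<Rightarrow>
   (dsym \<Rightarrow> 'x \<Rightarrow> 'v \<Rightarrow> 'w) \<Rightarrow> (dsym \<Rightarrow> 'u \<Rightarrow> 'z \<Rightarrow> 'w) \<Rightarrow> bool"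
  where "dialgebra_identities p q r s \<longleftrightarrow> (\<forall>x y z.
    r Dashv x (q Dashv y z) = s Dashv (p Dashv x y) z \<and>
    s Dashv (p Dashv x y) z = r Dashv x (q Vdash y z) \<and>
    s Dashv (p Vdash x y) z = r Vdash x (q Dashv y z) \<and>
    s Vdash (p Dashv x y) z = r Vdash x (q Vdash y z) \<and>
    r Vdash x (q Vdash y z) = s Vdash (p Vdash x y) z)"

locale dialgebra = vector_space sc
  for sc :: "'k::field \<Rightarrow> 'd::ab_group_add \<Rightarrow> 'd" +
  fixes mul :: "dsym \<Rightarrow> 'd \<Rightarrow> 'd \<Rightarrow> 'd"
  assumes bilinear: "bilinear_map sc sc sc (mul s)"
    and identities: "dialgebra_identities mul mul mul mul"

locale dialgebra_morphism =
  D: dialgebra scD mulD + E: dialgebra scE mulE + Vector_Spaces.linear scD scE \<psi>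
  for scD :: "'k::field \<Rightarrow> 'd::ab_group_add \<Rightarrow> 'd" and mulD :: "dsym \<Rightarrow> 'd \<Rightarrow> 'd \<Rightarrow> 'd"
    and scE :: "'k \<Rightarrow> 'e::ab_group_add \<Rightarrow> 'e" and mulE :: "dsym \<Rightarrow> 'e \<Rightarrow> 'e \<Rightarrow> 'e"
    and \<psi> :: "'d \<Rightarrow> 'e" +
  assumes preserves: "\<psi> (mulD s x y) = mulE s (\<psi> x) (\<psi> y)"

locale dialgebra_representation =
  D: dialgebra sc mul + M: vector_space scM
  for sc :: "'k::field \<Rightarrow> 'd::ab_group_add \<Rightarrow> 'd" and mul :: "dsym \<Rightarrow> 'd \<Rightarrow> 'd \<Rightarrow> 'd"
    and scM :: "'k \<Rightarrow> 'm::ab_group_add \<Rightarrow> 'm" +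
  fixes la :: "dsym \<Rightarrow> 'd \<Rightarrow> 'm \<Rightarrow> 'm" and ra :: "dsym \<Rightarrow> 'm \<Rightarrow> 'd \<Rightarrow> 'm"
  assumes left_bilinear: "bilinear_map sc scM scM (la s)"
    and right_bilinear: "bilinear_map scM sc scM (ra s)"
    and identities_x: "dialgebra_identities ra mul ra ra"
    and identities_y: "dialgebra_identities la ra la ra"
    and identities_z: "dialgebra_identities mul la la la"

lemma (in dialgebra) self_representation: "dialgebra_representation sc mul sc mul mul"
  by unfold_locales (simp_all add: bilinear identities)

lemma (in dialgebra_morphism) target_representation:
  "dialgebra_representation scD mulD scE (\<lambda>s a e. mulE s (\<psi> a) e) (\<lambda>s e a. mulE s e (\<psi> a))"
proof unfold_locales
  have comp: "Vector_Spaces.linear scD scE (\<lambda>x. f (\<psi> x))"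
    if "Vector_Spaces.linear scE scE f" for f
    using Vector_Spaces.linear_compose[OF linear_axioms that] by (simp add: o_def)
  show "bilinear_map scD scE scE (\<lambda>a e. mulE s (\<psi> a) e)" for s
    using E.bilinear comp[of "\<lambda>x. mulE s x y" for y] by (simp add: bilinear_map_def)
  show "bilinear_map scE scD scE (\<lambda>e a. mulE s e (\<psi> a))" for s
    using E.bilinear comp[of "\<lambda>y. mulE s x y" for x] by (simp add: bilinear_map_def)
qed (use E.identities in \<open>simp_all add: dialgebra_identities_def preserves\<close>)

datatype pbtree = Leaf | Graft pbtree pbtree (infixr "\<or>\<^sub>t" 65)

fun leaves :: "pbtree \<Rightarrow> nat" where
  "leaves Leaf = 1"
| "leaves (l \<or>\<^sub>t r) = leaves l + leaves r"

definition Y :: "nat \<Rightarrow> pbtree set" where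
  "Y n = {y. leaves y = n + 1}"

definition tree21 :: pbtree where "tree21 = Leaf \<or>\<^sub>t (Leaf \<or>\<^sub>t Leaf)"
definition tree12 :: pbtree where "tree12 = (Leaf \<or>\<^sub>t Leaf) \<or>\<^sub>t Leaf"

text \<open>
  \<open>del_leaf i y\<close> is \<open>d\<^sub>i y\<close>: the \<open>i\<close>th leaf (numbered from 0) is removed together with the vertex
  it is attached to. The value at \<open>Leaf\<close> is irrelevant.
\<close>

fun del_leaf :: "nat \<Rightarrow> pbtree \<Rightarrow> pbtree" where
  "del_leaf i Leaf = Leaf"
| "del_leaf i (l \<or>\<^sub>t r) =
    (if i < leaves l then (if l = Leaf then r else del_leaf i l \<or>\<^sub>t r)
     else (if r = Leaf then l else l \<or>\<^sub>t del_leaf (i - leaves l) r))"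

text \<open>Whether the \<open>i\<close>th leaf is the left branch at its vertex; irrelevant at \<open>Leaf\<close>.\<close>

fun left_branch :: "nat \<Rightarrow> pbtree \<Rightarrow> bool" where
  "left_branch i Leaf \<longleftrightarrow> False"
| "left_branch i (l \<or>\<^sub>t r) \<longleftrightarrow>
    (if i < leaves l then l = Leaf \<or> left_branch i l
     else r \<noteq> Leaf \<and> left_branch (i - leaves l) r)"

text \<open>\<open>circ n y i\<close> is the symbol of \<open>y \<in> Y (n + 1)\<close> at position \<open>i \<le> n + 1\<close>.\<close>

definition circ :: "nat \<Rightarrow> pbtree \<Rightarrow> nat \<Rightarrow> dsym" where
  "circ n y i =
    (if i = 0 then (if \<exists>y1. y = Leaf \<or>\<^sub>t y1 then Dashv else Vdash)
     else if i = n + 1 then (if \<exists>y1. y = y1 \<or>\<^sub>t Leaf then Vdash else Dashv)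
     else (if left_branch i y then Dashv else Vdash))"

text \<open>
  By the universal property, a linear map \<open>K[Y\<^sub>n] \<otimes> D\<^sup>\<otimes>\<^sup>n \<rightarrow> M\<close> is a family of \<open>n\<close>-linear maps
  indexed by \<open>Y n\<close>. The arguments \<open>a\<^sub>1, \<dots>, a\<^sub>n\<close> form a list (so \<open>a\<^sub>i\<close> is \<open>as ! (i - 1)\<close>), and cochains
  vanish outside their domain, so that equality of cochains is equality of functions.
\<close>

type_synonym ('d, 'm) cochain = "pbtree \<Rightarrow> 'd list \<Rightarrow> 'm"

definition CY ::
  "('k::field \<Rightarrow> 'd::ab_group_add \<Rightarrow> 'd) \<Rightarrow> ('k \<Rightarrow> 'm::ab_group_add \<Rightarrow> 'm) \<Rightarrow>
   nat \<Rightarrow> ('d, 'm) cochain set"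
  where "CY sc scM n = {f.
    (\<forall>y as. y \<notin> Y n \<or> length as \<noteq> n \<longrightarrow> f y as = 0) \<and>
    (\<forall>y\<in>Y n. \<forall>as i. length as = n \<longrightarrow> i < n \<longrightarrow>
       Vector_Spaces.linear sc scM (\<lambda>x. f y (as[i := x])))}"

text \<open>\<open>coface mul la ra n i\<close> is \<open>\<delta>\<^sup>i\<close> from degree \<open>n\<close> to degree \<open>n + 1\<close>, for a dialgebra with products
  \<open>mul\<close> and a representation with left actions \<open>la\<close> and right actions \<open>ra\<close>.\<close>

definition coface ::
  "(dsym \<Rightarrow> 'd \<Rightarrow> 'd \<Rightarrow> 'd) \<Rightarrow> (dsym \<Rightarrow> 'd \<Rightarrow> 'm \<Rightarrow> 'm) \<Rightarrow> (dsym \<Rightarrow> 'm \<Rightarrow> 'd \<Rightarrow> 'm) \<Rightarrow>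
   nat \<Rightarrow> nat \<Rightarrow> ('d, 'm) cochain \<Rightarrow> ('d, 'm) cochain"
  where "coface mul la ra n i f = (\<lambda>y as.
    if i = 0 then la (circ n y 0) (hd as) (f (del_leaf 0 y) (tl as))
    else if i = n + 1 then ra (circ n y (n + 1)) (f (del_leaf (n + 1) y) (butlast as)) (last as)
    else f (del_leaf i y)
      (take (i - 1) as @ [mul (circ n y i) (as ! (i - 1)) (as ! i)] @ drop (i + 1) as))"

definition coboundary ::
  "(dsym \<Rightarrow> 'd \<Rightarrow> 'd \<Rightarrow> 'd) \<Rightarrow> (dsym \<Rightarrow> 'd \<Rightarrow> 'm \<Rightarrow> 'm) \<Rightarrow> (dsym \<Rightarrow> 'm \<Rightarrow> 'd \<Rightarrow> 'm) \<Rightarrow>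
   nat \<Rightarrow> ('d, 'm::ab_group_add) cochain \<Rightarrow> ('d, 'm) cochain"
  where "coboundary mul la ra n f = (\<lambda>y as.
    if y \<in> Y (n + 1) \<and> length as = n + 1
    then \<Sum>i\<le>n + 1. (if even i then coface mul la ra n i f y as else - coface mul la ra n i f y as)
    else 0)"

type_synonym ('d, 'e) triple = "('d, 'd) cochain \<times> ('e, 'e) cochain \<times> ('d, 'e) cochain"

text \<open>Only meant for \<open>n \<ge> 1\<close>.\<close>

definition CY_morphism ::
  "('k::field \<Rightarrow> 'd::ab_group_add \<Rightarrow> 'd) \<Rightarrow> ('k \<Rightarrow> 'e::ab_group_add \<Rightarrow> 'e) \<Rightarrow>
   nat \<Rightarrow> ('d, 'e) triple set"
  where "CY_morphism scD scE n = CY scD scD n \<times> CY scE scE n \<times> CY scD scE (n - 1)"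

fun coboundary_morphism ::
  "(dsym \<Rightarrow> 'd \<Rightarrow> 'd \<Rightarrow> 'd) \<Rightarrow> (dsym \<Rightarrow> 'e \<Rightarrow> 'e \<Rightarrow> 'e) \<Rightarrow> ('d \<Rightarrow> 'e) \<Rightarrow>
   nat \<Rightarrow> ('d::ab_group_add, 'e::ab_group_add) triple \<Rightarrow> ('d, 'e) triple"
  where "coboundary_morphism mulD mulE \<psi> n (\<xi>, \<pi>, \<phi>) =
    (coboundary mulD mulD mulD n \<xi>,
     coboundary mulE mulE mulE n \<pi>,
     (\<lambda>y as. \<psi> (\<xi> y as)) - (\<lambda>y as. \<pi> y (map \<psi> as)) -
       coboundary mulD (\<lambda>s a e. mulE s (\<psi> a) e) (\<lambda>s e a. mulE s e (\<psi> a)) (n - 1) \<phi>)"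

definition cocycles_morphism ::
  "('k::field \<Rightarrow> 'd::ab_group_add \<Rightarrow> 'd) \<Rightarrow> (dsym \<Rightarrow> 'd \<Rightarrow> 'd \<Rightarrow> 'd) \<Rightarrow>
   ('k \<Rightarrow> 'e::ab_group_add \<Rightarrow> 'e) \<Rightarrow> (dsym \<Rightarrow> 'e \<Rightarrow> 'e \<Rightarrow> 'e) \<Rightarrow> ('d \<Rightarrow> 'e) \<Rightarrow>
   nat \<Rightarrow> ('d, 'e) triple set"
  where "cocycles_morphism scD mulD scE mulE \<psi> n =
    {\<theta> \<in> CY_morphism scD scE n. coboundary_morphism mulD mulE \<psi> n \<theta> = 0}"

definition fps_scale :: "('k \<Rightarrow> 'd \<Rightarrow> 'd) \<Rightarrow> 'k \<Rightarrow> 'd fps \<Rightarrow> 'd fps" where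
  "fps_scale sc c a = Abs_fps (\<lambda>m. sc c (fps_nth a m))"

definition fps_product ::
  "(nat \<Rightarrow> dsym \<Rightarrow> 'd \<Rightarrow> 'd \<Rightarrow> 'd) \<Rightarrow> dsym \<Rightarrow> 'd::ab_group_add fps \<Rightarrow> 'd fps \<Rightarrow> 'd fps" where
  "fps_product F s a b =
    Abs_fps (\<lambda>m. \<Sum>(n, i, j)\<in>{(n, i, j). n + i + j = m}. F n s (fps_nth a i) (fps_nth b j))"

definition fps_map :: "(nat \<Rightarrow> 'd \<Rightarrow> 'e) \<Rightarrow> 'd fps \<Rightarrow> 'e::ab_group_add fps" where
  "fps_map \<phi> a = Abs_fps (\<lambda>m. \<Sum>(n, i)\<in>{(n, i). n + i = m}. \<phi> n (fps_nth a i))"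

lemma finite_fps_product_indices: "finite {(n, i, j). n + i + j = (m::nat)}"
  by (rule finite_subset[of _ "{..m} \<times> {..m} \<times> {..m}"]) auto

lemma finite_fps_map_indices: "finite {(n, i). n + i = (m::nat)}"
  by (rule finite_subset[of _ "{..m} \<times> {..m}"]) auto

text \<open>
  \<open>F n Dashv\<close> and \<open>F n Vdash\<close> are the coefficients of \<open>t\<^sup>n\<close> in the two power series of bilinear maps.
  The dialgebra \<open>D[[t]]\<close> is regarded over \<open>K\<close>; its products are \<open>K[[t]]\<close>-bilinear by construction.
\<close>

definition dialgebra_deformation ::
  "('k::field \<Rightarrow> 'd::ab_group_add \<Rightarrow> 'd) \<Rightarrow> (dsym \<Rightarrow> 'd \<Rightarrow> 'd \<Rightarrow> 'd) \<Rightarrow>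
   (nat \<Rightarrow> dsym \<Rightarrow> 'd \<Rightarrow> 'd \<Rightarrow> 'd) \<Rightarrow> bool"
  where "dialgebra_deformation sc mul F \<longleftrightarrow>
    (\<forall>n s. bilinear_map sc sc sc (F n s)) \<and> F 0 = mul \<and>
    dialgebra (fps_scale sc) (fps_product F)"

definition morphism_deformation ::
  "('k::field \<Rightarrow> 'd::ab_group_add \<Rightarrow> 'd) \<Rightarrow> (dsym \<Rightarrow> 'd \<Rightarrow> 'd \<Rightarrow> 'd) \<Rightarrow>
   ('k \<Rightarrow> 'e::ab_group_add \<Rightarrow> 'e) \<Rightarrow> (dsym \<Rightarrow> 'e \<Rightarrow> 'e \<Rightarrow> 'e) \<Rightarrow> ('d \<Rightarrow> 'e) \<Rightarrow>
   (nat \<Rightarrow> dsym \<Rightarrow> 'd \<Rightarrow> 'd \<Rightarrow> 'd) \<Rightarrow> (nat \<Rightarrow> dsym \<Rightarrow> 'e \<Rightarrow> 'e \<Rightarrow> 'e) \<Rightarrow> (nat \<Rightarrow> 'd \<Rightarrow> 'e) \<Rightarrow> bool"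
  where "morphism_deformation scD mulD scE mulE \<psi> FD FE \<Psi> \<longleftrightarrow>
    dialgebra_deformation scD mulD FD \<and> dialgebra_deformation scE mulE FE \<and>
    (\<forall>n. Vector_Spaces.linear scD scE (\<Psi> n)) \<and> \<Psi> 0 = \<psi> \<and>
    dialgebra_morphism (fps_scale scD) (fps_product FD) (fps_scale scE) (fps_product FE) (fps_map \<Psi>)"

definition cochain_of_products :: "(dsym \<Rightarrow> 'd \<Rightarrow> 'd \<Rightarrow> 'd) \<Rightarrow> ('d, 'd::ab_group_add) cochain" where
  "cochain_of_products G = (\<lambda>y as.
    if length as = 2 \<and> y = tree21 then G Dashv (as ! 0) (as ! 1)
    else if length as = 2 \<and> y = tree12 then G Vdash (as ! 0) (as ! 1)
    else 0)"

definition cochain_of_map :: "('d \<Rightarrow> 'e) \<Rightarrow> ('d, 'e::ab_group_add) cochain" where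
  "cochain_of_map \<phi> = (\<lambda>y as. if length as = 1 \<and> y = Leaf \<or>\<^sub>t Leaf then \<phi> (as ! 0) else 0)"

text \<open>The coefficient \<open>\<theta>\<^sub>n\<close> of a deformation of a morphism; \<open>\<theta>\<^sub>1\<close> is its infinitesimal.\<close>

definition deformation_coeff ::
  "(nat \<Rightarrow> dsym \<Rightarrow> 'd \<Rightarrow> 'd \<Rightarrow> 'd) \<Rightarrow> (nat \<Rightarrow> dsym \<Rightarrow> 'e \<Rightarrow> 'e \<Rightarrow> 'e) \<Rightarrow> (nat \<Rightarrow> 'd \<Rightarrow> 'e) \<Rightarrow>
   nat \<Rightarrow> ('d::ab_group_add, 'e::ab_group_add) triple"
  where "deformation_coeff FD FE \<Psi> n =
    (cochain_of_products (FD n), cochain_of_products (FE n), cochain_of_map (\<Psi> n))"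

abbreviation infinitesimal ::
  "(nat \<Rightarrow> dsym \<Rightarrow> 'd \<Rightarrow> 'd \<Rightarrow> 'd) \<Rightarrow> (nat \<Rightarrow> dsym \<Rightarrow> 'e \<Rightarrow> 'e \<Rightarrow> 'e) \<Rightarrow> (nat \<Rightarrow> 'd \<Rightarrow> 'e) \<Rightarrow>
   ('d::ab_group_add, 'e::ab_group_add) triple"
  where "infinitesimal FD FE \<Psi> \<equiv> deformation_coeff FD FE \<Psi> 1"

end

theory Submission
  imports Defs
begin

text \<open>
  If the coefficients of \<open>t\<^sup>i\<close> vanish for \<open>0 < i < m\<close>, then comparing coefficients of \<open>t\<^sup>m\<close>
  in the identities satisfied by \<open>\<Theta>\<^sub>t\<close> on constant power series leaves only the terms in which
  exactly one factor has index \<open>m\<close> and the others have index \<open>0\<close>. The five dialgebra identities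
  then become the vanishing of the coboundary on the five \<open>3\<close>-trees, and multiplicativity of
  \<open>\<Psi>\<^sub>t\<close> becomes the vanishing of the third component on the two \<open>2\<close>-trees.
\<close>

section \<open>Coefficients of power series that vanish strictly between degrees 0 and
  \<open>m\<close>\<close>

lemma linear_zero:
  assumes "Vector_Spaces.linear s1 s2 f"
  shows "f 0 = 0"
proof -
  interpret Vector_Spaces.linear s1 s2 f by fact
  show ?thesis by (rule zero)
qed

lemma bilinear_map_zero:
  assumes "bilinear_map sa sb sc B"
  shows "B 0 y = 0" "B x 0 = 0"
proof -
  have "Vector_Spaces.linear sb sc (\<lambda>y. B x y)" "Vector_Spaces.linear sa sc (\<lambda>x. B x y)"
    using assms by (simp_all add: bilinear_map_def)
  then show "B 0 y = 0" "B x 0 = 0"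
    using linear_zero by fast+
qed

lemma fps_product_nth_0: "fps_nth (fps_product F s a b) 0 = F 0 s (fps_nth a 0) (fps_nth b 0)"
proof -
  have "{(n, i, j). n + i + j = (0::nat)} = {(0, 0, 0)}" by auto
  then show ?thesis by (simp add: fps_product_def)
qed

lemma fps_map_nth_0: "fps_nth (fps_map \<phi> a) 0 = \<phi> 0 (fps_nth a 0)"
proof -
  have "{(n, i). n + i = (0::nat)} = {(0, 0)}" by auto
  then show ?thesis by (simp add: fps_map_def)
qed

text \<open>If three indices with sum \<open>m\<close> avoid the open interval from 0 to
  \<open>m\<close>, then one of them is \<open>m\<close> and the others are 0; any other summand has
  a zero coefficient map or a zero argument. A sum \<open>k\<close> inside the interval always
  forces an index into it. This second part shows that a product satisfies the same hypothesis as
  its factors, so that the lemma can be applied to nested products.\<close>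

lemma fps_product_nth_gap:
  assumes bil: "\<And>n. bilinear_map sc sc sc (F n s)"
    and m: "0 < m"
    and F: "\<And>i x y. 0 < i \<Longrightarrow> i < m \<Longrightarrow> F i s x y = 0"
    and a: "\<And>i. 0 < i \<Longrightarrow> i < m \<Longrightarrow> fps_nth a i = 0"
    and b: "\<And>i. 0 < i \<Longrightarrow> i < m \<Longrightarrow> fps_nth b i = 0"
  shows "fps_nth (fps_product F s a b) m =
    F m s (fps_nth a 0) (fps_nth b 0) + F 0 s (fps_nth a m) (fps_nth b 0)
      + F 0 s (fps_nth a 0) (fps_nth b m)"
    and "\<And>i. 0 < i \<Longrightarrow> i < m \<Longrightarrow> fps_nth (fps_product F s a b) i = 0"
proof -
  note zero = bilinear_map_zero[OF bil]
  let ?f = "\<lambda>(n, i, j). F n s (fps_nth a i) (fps_nth b j)"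
  have van: "?f (n, i, j) = 0" if "0 < n \<and> n < m \<or> 0 < i \<and> i < m \<or> 0 < j \<and> j < m" for n i j
    using that by (auto simp: F a b zero)
  have "fps_nth (fps_product F s a b) m = sum ?f {(n, i, j). n + i + j = m}"
    by (simp add: fps_product_def)
  also have "\<dots> = sum ?f {(m, 0, 0), (0, m, 0), (0, 0, m)}"
  proof (rule sum.mono_neutral_right)
    show "\<forall>p\<in>{(n, i, j). n + i + j = m} - {(m, 0, 0), (0, m, 0), (0, 0, m)}. ?f p = 0"
    proof
      fix p assume p: "p \<in> {(n, i, j). n + i + j = m} - {(m, 0, 0), (0, m, 0), (0, 0, m)}"
      obtain n i j where nij: "p = (n, i, j)" by (cases p)
      have "0 < n \<and> n < m \<or> 0 < i \<and> i < m \<or> 0 < j \<and> j < m"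
        using p by (auto simp: nij)
      then show "?f p = 0" unfolding nij by (rule van)
    qed
  qed (auto simp: finite_fps_product_indices)
  also have "\<dots> = F m s (fps_nth a 0) (fps_nth b 0) + F 0 s (fps_nth a m) (fps_nth b 0)
      + F 0 s (fps_nth a 0) (fps_nth b m)"
    using m by (simp add: add.assoc)
  finally show "fps_nth (fps_product F s a b) m = \<dots>" .
  fix k :: nat assume "0 < k" "k < m"
  then have "0 < n \<and> n < m \<or> 0 < i \<and> i < m \<or> 0 < j \<and> j < m" if "n + i + j = k" for n i j
    using that by linarith
  then have "sum ?f {(n, i, j). n + i + j = k} = 0"
    using van by (intro sum.neutral) blast
  then show "fps_nth (fps_product F s a b) k = 0"
    by (simp add: fps_product_def)
qed

lemma fps_map_nth_gap:
  assumes lin: "\<And>n. Vector_Spaces.linear sc sc' (\<phi> n)"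
    and m: "0 < m"
    and \<phi>: "\<And>i x. 0 < i \<Longrightarrow> i < m \<Longrightarrow> \<phi> i x = 0"
    and a: "\<And>i. 0 < i \<Longrightarrow> i < m \<Longrightarrow> fps_nth a i = 0"
  shows "fps_nth (fps_map \<phi> a) m = \<phi> m (fps_nth a 0) + \<phi> 0 (fps_nth a m)"
    and "\<And>i. 0 < i \<Longrightarrow> i < m \<Longrightarrow> fps_nth (fps_map \<phi> a) i = 0"
proof -
  note zero = linear_zero[OF lin]
  let ?f = "\<lambda>(n, i). \<phi> n (fps_nth a i)"
  have van: "?f (n, i) = 0" if "0 < n \<and> n < m \<or> 0 < i \<and> i < m" for n i
    using that by (auto simp: \<phi> a zero)
  have "fps_nth (fps_map \<phi> a) m = sum ?f {(n, i). n + i = m}"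
    by (simp add: fps_map_def)
  also have "\<dots> = sum ?f {(m, 0), (0, m)}"
  proof (rule sum.mono_neutral_right)
    show "\<forall>p\<in>{(n, i). n + i = m} - {(m, 0), (0, m)}. ?f p = 0"
    proof
      fix p assume p: "p \<in> {(n, i). n + i = m} - {(m, 0), (0, m)}"
      obtain n i where ni: "p = (n, i)" by (cases p)
      have "0 < n \<and> n < m \<or> 0 < i \<and> i < m"
        using p by (auto simp: ni)
      then show "?f p = 0" unfolding ni by (rule van)
    qed
  qed (auto simp: finite_fps_map_indices)
  also have "\<dots> = \<phi> m (fps_nth a 0) + \<phi> 0 (fps_nth a m)"
    using m by simp
  finally show "fps_nth (fps_map \<phi> a) m = \<dots>" .
  fix k :: nat assume "0 < k" "k < m"
  then have "0 < n \<and> n < m \<or> 0 < i \<and> i < m" if "n + i = k" for n i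
    using that by linarith
  then have "sum ?f {(n, i). n + i = k} = 0"
    using van by (intro sum.neutral) blast
  then show "fps_nth (fps_map \<phi> a) k = 0"
    by (simp add: fps_map_def)
qed

section \<open>Planar binary trees with at most four leaves\<close>

lemma leaves_pos: "0 < leaves y"
  by (induction y) auto

lemma leaves_eq_1_iff: "leaves y = Suc 0 \<longleftrightarrow> y = Leaf"
proof (cases y)
  case (Graft l r)
  then show ?thesis using leaves_pos[of l] leaves_pos[of r] by simp
qed simp

text \<open>The recursion behind the enumeration of \<open>Y 1\<close>, \<open>Y 2\<close> and
  \<open>Y 3\<close>. Since every tree has a leaf, both subtree counts can be written as successors,
  and \<open>k\<close> ranges over a finite set.\<close>

lemma leaves_eq_Suc_Suc_iff:
  "leaves y = Suc (Suc n) \<longleftrightarrow> (\<exists>l r k. k \<le> n \<and> y = l \<or>\<^sub>t r \<and> leaves l = Suc k \<and> leaves r = Suc (n - k))"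
proof (cases y)
  case (Graft l r)
  then show ?thesis using leaves_pos[of l] leaves_pos[of r]
    by (auto intro!: exI[of _ "leaves l - 1"])
qed simp

lemma leaves_eq_2_iff: "leaves y = Suc (Suc 0) \<longleftrightarrow> y = Leaf \<or>\<^sub>t Leaf"
  by (auto simp: leaves_eq_Suc_Suc_iff leaves_eq_1_iff)

lemma Y_1: "Y (Suc 0) = {Leaf \<or>\<^sub>t Leaf}"
  by (auto simp: Y_def leaves_eq_2_iff)

lemma Y_2: "Y 2 = {tree21, tree12}"
  by (auto simp: Y_def tree21_def tree12_def leaves_eq_Suc_Suc_iff[of _ "Suc 0"] le_Suc_eq
      leaves_eq_1_iff leaves_eq_2_iff numeral_eq_Suc)

lemma Y_3: "Y 3 = {Leaf \<or>\<^sub>t tree21, Leaf \<or>\<^sub>t tree12, (Leaf \<or>\<^sub>t Leaf) \<or>\<^sub>t (Leaf \<or>\<^sub>t Leaf),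
  tree21 \<or>\<^sub>t Leaf, tree12 \<or>\<^sub>t Leaf}"
proof (rule set_eqI)
  fix y
  have Y_2': "leaves z = Suc (Suc (Suc 0)) \<longleftrightarrow> z = tree21 \<or> z = tree12" for z
    using Y_2 by (simp add: set_eq_iff Y_def numeral_eq_Suc)
  have "y \<in> Y 3 \<longleftrightarrow> leaves y = Suc (Suc (Suc (Suc 0)))"
    by (simp add: Y_def numeral_eq_Suc)
  \<comment> \<open>The leaves split between the two subtrees as 1 + 3, 2 + 2 or 3 + 1, which
    contributes two, one and two trees.\<close>
  also have "\<dots> \<longleftrightarrow> (\<exists>l r k. (k = 0 \<or> k = 1 \<or> k = 2) \<and> y = l \<or>\<^sub>t r \<and>
      leaves l = Suc k \<and> leaves r = Suc (Suc (Suc 0) - k))"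
    unfolding leaves_eq_Suc_Suc_iff[of _ "Suc (Suc 0)"] by (simp add: le_Suc_eq numeral_2_eq_2 disj_ac)
  also have "\<dots> \<longleftrightarrow> (\<exists>l r. y = l \<or>\<^sub>t r \<and> (l = Leaf \<and> (r = tree21 \<or> r = tree12) \<or>
      l = Leaf \<or>\<^sub>t Leaf \<and> r = Leaf \<or>\<^sub>t Leaf \<or> (l = tree21 \<or> l = tree12) \<and> r = Leaf))"
    unfolding ex_disj_distrib conj_disj_distribR
    by (simp add: leaves_eq_1_iff leaves_eq_2_iff Y_2' numeral_2_eq_2) blast
  finally show "y \<in> Y 3 \<longleftrightarrow> y \<in> {Leaf \<or>\<^sub>t tree21, Leaf \<or>\<^sub>t tree12, (Leaf \<or>\<^sub>t Leaf) \<or>\<^sub>t (Leaf \<or>\<^sub>t Leaf),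
      tree21 \<or>\<^sub>t Leaf, tree12 \<or>\<^sub>t Leaf}"
    by blast
qed

section \<open>Products and linear maps as cochains of degree 2 and 1\<close>

lemma cochain_of_products_in_CY:
  assumes "\<And>s. bilinear_map sc sc sc (G s)"
  shows "cochain_of_products G \<in> CY sc sc 2"
proof -
  have ne: "tree21 \<noteq> tree12" by (simp add: tree21_def tree12_def)
  have "Vector_Spaces.linear sc sc (\<lambda>x. cochain_of_products G y (as[i := x]))"
    if "y \<in> Y 2" "length as = 2" "i < 2" for y as i
  proof -
    have "i = 0 \<or> i = 1" using that by auto
    then show ?thesis using that assms ne
      by (auto simp: cochain_of_products_def Y_2 bilinear_map_def)
  qed
  moreover have "cochain_of_products G y as = 0" if "y \<notin> Y 2 \<or> length as \<noteq> 2" for y as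
    using that by (auto simp: cochain_of_products_def Y_2)
  ultimately show ?thesis by (simp add: CY_def)
qed

lemma cochain_of_map_in_CY:
  assumes "Vector_Spaces.linear sc scM \<phi>"
  shows "cochain_of_map \<phi> \<in> CY sc scM (Suc 0)"
  using assms by (auto simp: CY_def cochain_of_map_def Y_1)

text \<open>Turns the vanishing of a coefficient of the deformation into the pointwise vanishing
  that the coefficient lemmas assume.\<close>

lemma cochain_of_products_eq_0_iff: "cochain_of_products G = 0 \<longleftrightarrow> (\<forall>s x y. G s x y = 0)"
proof
  assume "cochain_of_products G = 0"
  then have "cochain_of_products G y as = 0" for y as by simp
  from this[of tree21 "[a, b]" for a b] this[of tree12 "[a, b]" for a b]
  have "G Dashv a b = 0" "G Vdash a b = 0" for a b
    by (simp_all add: cochain_of_products_def tree21_def tree12_def)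
  then show "\<forall>s x y. G s x y = 0" by (metis dsym.exhaust)
qed (auto simp: cochain_of_products_def fun_eq_iff)

lemma cochain_of_map_eq_0_iff: "cochain_of_map \<phi> = 0 \<longleftrightarrow> (\<forall>x. \<phi> x = 0)"
proof
  assume "cochain_of_map \<phi> = 0"
  then have "cochain_of_map \<phi> y as = 0" for y as by simp
  from this[of "Leaf \<or>\<^sub>t Leaf" "[a]" for a]
  show "\<forall>x. \<phi> x = 0" by (simp add: cochain_of_map_def)
qed (auto simp: cochain_of_map_def fun_eq_iff)

section \<open>The dialgebra identities and the five 3-trees\<close>

text \<open>
  \<open>(s1, s2, s3, s4)\<close> stands for the identity \<open>x s1 (y s2 z) = (x s4 y) s3 z\<close>.
\<close>

definition associativity_symbols :: "(dsym \<times> dsym \<times> dsym \<times> dsym) set" where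
  "associativity_symbols = {(Dashv, Dashv, Dashv, Dashv), (Dashv, Vdash, Dashv, Dashv),
    (Vdash, Dashv, Dashv, Vdash), (Vdash, Vdash, Vdash, Dashv), (Vdash, Vdash, Vdash, Vdash)}"

text \<open>With all five identities in one shape, the linearization can be carried out once for a
  generic quadruple of symbols.\<close>

lemma dialgebra_identities_iff:
  "dialgebra_identities p q r s \<longleftrightarrow>
    (\<forall>(s1, s2, s3, s4)\<in>associativity_symbols. \<forall>x y z. r s1 x (q s2 y z) = s s3 (p s4 x y) z)"
  unfolding dialgebra_identities_def associativity_symbols_def
  by (simp only: ball_simps prod.case) metis

text \<open>The linear part of the dialgebra identities for \<open>mul + \<epsilon> G\<close>.\<close>

definition linearized_identities ::
  "(dsym \<Rightarrow> 'd \<Rightarrow> 'd \<Rightarrow> 'd::ab_group_add) \<Rightarrow> (dsym \<Rightarrow> 'd \<Rightarrow> 'd \<Rightarrow> 'd) \<Rightarrow> bool"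
  where "linearized_identities mul G \<longleftrightarrow>
    (\<forall>(s1, s2, s3, s4)\<in>associativity_symbols. \<forall>x y z.
      mul s1 x (G s2 y z) + G s1 x (mul s2 y z) = mul s3 (G s4 x y) z + G s3 (mul s4 x y) z)"

text \<open>The 3-trees, as listed in \<open>Y_3\<close>, match the quadruples of
  \<open>associativity_symbols\<close> in the order given there. On the tree of
  \<open>(s1, s2, s3, s4)\<close> the symbols at positions 0, 1, 2, 3 are \<open>s1\<close>,
  \<open>s4\<close>, \<open>s2\<close>, \<open>s3\<close>, and deleting leaf 0, 1, 2, 3 leaves the
  2-tree of \<open>s2\<close>, \<open>s3\<close>, \<open>s1\<close>, \<open>s4\<close>.\<close>

lemma coboundary_cochain_of_products:
  assumes "linearized_identities mul G"
  shows "coboundary mul mul mul 2 (cochain_of_products G) = 0"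
proof -
  \<comment> \<open>The four signed terms are the cofaces of index 0, 1, 2, 3 in this order.\<close>
  have id: "mul s1 a (G s2 b c) - G s3 (mul s4 a b) c + G s1 a (mul s2 b c) - mul s3 (G s4 a b) c = 0"
    if "(s1, s2, s3, s4) \<in> associativity_symbols" for s1 s2 s3 s4 a b c
  proof -
    have "mul s1 a (G s2 b c) + G s1 a (mul s2 b c) = mul s3 (G s4 a b) c + G s3 (mul s4 a b) c"
      using that assms unfolding linearized_identities_def by fast
    then show ?thesis by (simp add: algebra_simps)
  qed
  have "coboundary mul mul mul 2 (cochain_of_products G) y as = 0" for y as
  proof (cases "y \<in> Y 3 \<and> length as = 3")
    case True
    then obtain a b c where as: "as = [a, b, c]"
      by (auto simp: numeral_eq_Suc length_Suc_conv)
    let ?c = "\<lambda>i. coface mul mul mul 2 i (cochain_of_products G) y as"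
    have 3: "2 + 1 = (3::nat)" "{..3::nat} = {0, 1, 2, 3}" by auto
    have sum: "coboundary mul mul mul 2 (cochain_of_products G) y as = ?c 0 - ?c 1 + ?c 2 - ?c 3"
      using True unfolding coboundary_def 3 by (simp add: algebra_simps)
    have "y \<in> {Leaf \<or>\<^sub>t tree21, Leaf \<or>\<^sub>t tree12, (Leaf \<or>\<^sub>t Leaf) \<or>\<^sub>t (Leaf \<or>\<^sub>t Leaf),
        tree21 \<or>\<^sub>t Leaf, tree12 \<or>\<^sub>t Leaf}"
      using True by (simp add: Y_3)
    then show ?thesis
      unfolding sum unfolding as
      by (elim insertE emptyE)
        (simp_all add: coface_def circ_def tree21_def tree12_def cochain_of_products_def id
          associativity_symbols_def)
  qed (auto simp: coboundary_def)
  then show ?thesis by (simp add: fun_eq_iff)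
qed

lemma linearized_identities_deformation:
  assumes def: "dialgebra_deformation sc mul F"
    and m: "0 < m"
    and F: "\<And>i s x y. 0 < i \<Longrightarrow> i < m \<Longrightarrow> F i s x y = 0"
  shows "linearized_identities mul (F m)"
proof -
  have bil: "bilinear_map sc sc sc (F n s)" and F0: "F 0 = mul" for n s
    using def by (auto simp: dialgebra_deformation_def)
  interpret dialgebra "fps_scale sc" "fps_product F"
    using def by (simp add: dialgebra_deformation_def)
  note zero = bilinear_map_zero[OF bil[of 0], unfolded F0]
  note gap = fps_product_nth_gap[OF bil m F]
  let ?P = "fps_product F"
  have const: "fps_nth (?P s (fps_const x) (fps_const y)) m = F m s x y" for s x y
    using m by (subst gap(1)) (auto simp: zero F0)
  \<comment> \<open>The inner product is not constant, but it vanishes strictly between degrees 0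
    and \<open>m\<close>, so the coefficient formula applies a second time. Its coefficients in
    degrees 0 and \<open>m\<close> yield the two summands; the third drops out because the outer
    factor is constant.\<close>
  have r: "fps_nth (?P s (fps_const x) (?P s' (fps_const y) (fps_const z))) m =
      mul s x (F m s' y z) + F m s x (mul s' y z)" for s s' x y z
    using m by (subst gap(1)) (auto simp: zero F0 const fps_product_nth_0 gap(2) add.commute)
  have l: "fps_nth (?P s (?P s' (fps_const x) (fps_const y)) (fps_const z)) m =
      mul s (F m s' x y) z + F m s (mul s' x y) z" for s s' x y z
    using m by (subst gap(1)) (auto simp: zero F0 const fps_product_nth_0 gap(2) add.commute)
  show ?thesis
    \<comment> \<open>Read backwards, \<open>l\<close> and \<open>r\<close> make each linearized
      identity the degree \<open>m\<close> coefficient of an identity of the deformed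
      dialgebra.\<close>
    unfolding linearized_identities_def l[symmetric] r[symmetric]
    using identities unfolding dialgebra_identities_iff by fastforce
qed

section \<open>Multiplicativity of the deformed morphism and the third component\<close>

lemma deformation_morphism_linearized:
  assumes def: "morphism_deformation scD mulD scE mulE \<psi> FD FE \<Psi>"
    and m: "0 < m"
    and FD: "\<And>i s x y. 0 < i \<Longrightarrow> i < m \<Longrightarrow> FD i s x y = 0"
    and FE: "\<And>i s x y. 0 < i \<Longrightarrow> i < m \<Longrightarrow> FE i s x y = 0"
    and \<Psi>: "\<And>i x. 0 < i \<Longrightarrow> i < m \<Longrightarrow> \<Psi> i x = 0"
  shows "\<Psi> m (mulD s x y) + \<psi> (FD m s x y) =
    FE m s (\<psi> x) (\<psi> y) + mulE s (\<Psi> m x) (\<psi> y) + mulE s (\<psi> x) (\<Psi> m y)"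
proof -
  have bilD: "bilinear_map scD scD scD (FD n s)" and FD0: "FD 0 = mulD"
    and bilE: "bilinear_map scE scE scE (FE n s)" and FE0: "FE 0 = mulE"
    and lin: "Vector_Spaces.linear scD scE (\<Psi> n)" and \<Psi>0: "\<Psi> 0 = \<psi>" for n s
    using def by (auto simp: morphism_deformation_def dialgebra_deformation_def)
  interpret dialgebra_morphism "fps_scale scD" "fps_product FD" "fps_scale scE" "fps_product FE"
    "fps_map \<Psi>"
    using def by (simp add: morphism_deformation_def)
  note zeroD = bilinear_map_zero[OF bilD[of 0], unfolded FD0]
  note zero\<psi> = linear_zero[OF lin[of 0], unfolded \<Psi>0]
  note gapD = fps_product_nth_gap[OF bilD m FD]
  note gapE = fps_product_nth_gap[OF bilE m FE]
  note gap\<Psi> = fps_map_nth_gap[OF lin m \<Psi>]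
  have const: "fps_nth (fps_product FD s (fps_const x) (fps_const y)) m = FD m s x y"
    using m by (subst gapD(1)) (auto simp: zeroD FD0)
  have const\<Psi>: "fps_nth (fps_map \<Psi> (fps_const x)) m = \<Psi> m x" for x
    using m by (subst gap\<Psi>(1)) (auto simp: zero\<psi> \<Psi>0)
  have "fps_nth (fps_map \<Psi> (fps_product FD s (fps_const x) (fps_const y))) m =
      \<Psi> m (mulD s x y) + \<psi> (FD m s x y)"
    using m by (subst gap\<Psi>(1)) (auto simp: gapD(2) const fps_product_nth_0 FD0 \<Psi>0)
  \<comment> \<open>The image of a constant series has \<open>\<psi> x\<close> in degree 0 and
    \<open>\<Psi> m x\<close> in degree \<open>m\<close>, so here all three terms of the coefficient
    formula survive.\<close>
  moreover have "fps_nth (fps_product FE s (fps_map \<Psi> (fps_const x)) (fps_map \<Psi> (fps_const y))) m =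
      FE m s (\<psi> x) (\<psi> y) + mulE s (\<Psi> m x) (\<psi> y) + mulE s (\<psi> x) (\<Psi> m y)"
    using m by (subst gapE(1)) (auto simp: gap\<Psi>(2) const\<Psi> fps_map_nth_0 FE0 \<Psi>0)
  ultimately show ?thesis by (simp add: preserves)
qed

text \<open>On \<open>tree21\<close> all three symbols in the coboundary of a 1-cochain are
  \<open>Dashv\<close>, on \<open>tree12\<close> they are \<open>Vdash\<close>. Each tree therefore
  gives the assumed relation for a single \<open>s\<close>.\<close>

lemma third_component_eq_0:
  assumes "\<And>s x y. \<phi> (mulD s x y) + \<psi> (G s x y) =
    H s (\<psi> x) (\<psi> y) + mulE s (\<phi> x) (\<psi> y) + mulE s (\<psi> x) (\<phi> y)"
    and "\<psi> 0 = 0"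
  shows "(\<lambda>y as. \<psi> (cochain_of_products G y as)) - (\<lambda>y as. cochain_of_products H y (map \<psi> as)) -
    coboundary mulD (\<lambda>s a e. mulE s (\<psi> a) e) (\<lambda>s e a. mulE s e (\<psi> a)) (Suc 0) (cochain_of_map \<phi>) = 0"
    (is "?A - ?B - ?C = 0")
proof -
  have eq: "\<psi> (G s x y) = H s (\<psi> x) (\<psi> y) + mulE s (\<phi> x) (\<psi> y) + mulE s (\<psi> x) (\<phi> y)
      - \<phi> (mulD s x y)" for s x y
    using assms(1)[of s x y] by (simp add: eq_diff_eq add.commute)
  have "?A y as - ?B y as - ?C y as = 0" for y as
  proof (cases "y \<in> Y 2 \<and> length as = 2")
    case True
    then obtain a b where as: "as = [a, b]"
      by (auto simp: numeral_eq_Suc length_Suc_conv)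
    let ?c = "\<lambda>i. coface mulD (\<lambda>s a e. mulE s (\<psi> a) e) (\<lambda>s e a. mulE s e (\<psi> a)) (Suc 0) i
      (cochain_of_map \<phi>) y as"
    have "{..Suc (Suc 0)} = {0, 1, 2}" by auto
    then have sum: "?C y as = ?c 0 - ?c 1 + ?c 2"
      using True by (simp add: coboundary_def numeral_2_eq_2[symmetric])
    have "y \<in> {tree21, tree12}"
      using True by (simp add: Y_2)
    then show ?thesis
      unfolding sum unfolding as
      by (auto simp: coface_def circ_def tree21_def tree12_def cochain_of_products_def
          cochain_of_map_def eq algebra_simps)
  next
    case False
    \<comment> \<open>Off the domain the first term is \<open>\<psi>\<close> applied to the default
      value 0, hence the need for \<open>\<psi> 0 = 0\<close>.\<close>
    then show ?thesis using assms(2)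
      by (auto simp: coboundary_def cochain_of_products_def Y_2 numeral_2_eq_2[symmetric])
  qed
  then show ?thesis by (simp add: fun_eq_iff)
qed

section \<open>The first nonvanishing coefficient is a cocycle\<close>

text \<open>Covers both claims of the theorem: for \<open>m = 1\<close> the hypothesis
  \<open>zero\<close> is vacuous, and for \<open>m = n + 1\<close> it says that the coefficients of
  index 1 to \<open>n\<close> vanish.\<close>

lemma deformation_coeff_in_cocycles:
  assumes def: "morphism_deformation scD mulD scE mulE \<psi> FD FE \<Psi>"
    and m: "0 < m"
    and zero: "\<And>i. 0 < i \<Longrightarrow> i < m \<Longrightarrow> deformation_coeff FD FE \<Psi> i = 0"
  shows "deformation_coeff FD FE \<Psi> m \<in> cocycles_morphism scD mulD scE mulE \<psi> 2"
proof -
  have D: "dialgebra_deformation scD mulD FD" and E: "dialgebra_deformation scE mulE FE"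
    and lin: "Vector_Spaces.linear scD scE (\<Psi> n)" and \<Psi>0: "\<Psi> 0 = \<psi>" for n
    using def by (auto simp: morphism_deformation_def)
  have bilD: "bilinear_map scD scD scD (FD n s)" and bilE: "bilinear_map scE scE scE (FE n s)" for n s
    using D E by (auto simp: dialgebra_deformation_def)
  have FD: "FD i s x y = 0" and FE: "FE i s u v = 0" and \<Psi>: "\<Psi> i x = 0"
    if "0 < i" "i < m" for i s x y u v
    using zero[OF that] by (simp_all add: deformation_coeff_def zero_prod_def
        cochain_of_products_eq_0_iff cochain_of_map_eq_0_iff)
  have "deformation_coeff FD FE \<Psi> m \<in> CY_morphism scD scE 2"
    by (simp add: CY_morphism_def deformation_coeff_def cochain_of_products_in_CY
        cochain_of_map_in_CY bilD bilE lin)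
  moreover have "coboundary_morphism mulD mulE \<psi> 2 (deformation_coeff FD FE \<Psi> m) = 0"
  proof -
    have "\<psi> 0 = 0"
      using linear_zero[OF lin[of 0]] by (simp add: \<Psi>0)
    moreover have "\<Psi> m (mulD s x y) + \<psi> (FD m s x y) =
        FE m s (\<psi> x) (\<psi> y) + mulE s (\<Psi> m x) (\<psi> y) + mulE s (\<psi> x) (\<Psi> m y)" for s x y
      by (rule deformation_morphism_linearized[OF def m FD FE \<Psi>])
    ultimately show ?thesis
      using coboundary_cochain_of_products[OF linearized_identities_deformation[OF D m FD]]
        coboundary_cochain_of_products[OF linearized_identities_deformation[OF E m FE]]
        third_component_eq_0[of "\<Psi> m" mulD \<psi> "FD m" "FE m" mulE]
      by (simp add: deformation_coeff_def zero_prod_def)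
  qed
  ultimately show ?thesis by (simp add: cocycles_morphism_def)
qed

theorem lemma4p5:
  fixes scD :: "'k::field \<Rightarrow> 'd::ab_group_add \<Rightarrow> 'd" and mulD :: "dsym \<Rightarrow> 'd \<Rightarrow> 'd \<Rightarrow> 'd"
    and scE :: "'k \<Rightarrow> 'e::ab_group_add \<Rightarrow> 'e" and mulE :: "dsym \<Rightarrow> 'e \<Rightarrow> 'e \<Rightarrow> 'e"
    and \<psi> :: "'d \<Rightarrow> 'e"
    and FD :: "nat \<Rightarrow> dsym \<Rightarrow> 'd \<Rightarrow> 'd \<Rightarrow> 'd" and FE :: "nat \<Rightarrow> dsym \<Rightarrow> 'e \<Rightarrow> 'e \<Rightarrow> 'e"
    and \<Psi> :: "nat \<Rightarrow> 'd \<Rightarrow> 'e"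
  assumes "dialgebra_morphism scD mulD scE mulE \<psi>"
    and "morphism_deformation scD mulD scE mulE \<psi> FD FE \<Psi>"
  shows "infinitesimal FD FE \<Psi> \<in> cocycles_morphism scD mulD scE mulE \<psi> 2 \<and>
    (\<forall>n. (\<forall>i\<in>{1..n}. deformation_coeff FD FE \<Psi> i = 0) \<longrightarrow>
      deformation_coeff FD FE \<Psi> (n + 1) \<in> cocycles_morphism scD mulD scE mulE \<psi> 2)"
  using deformation_coeff_in_cocycles[OF assms(2)] by auto

end
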